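(* Let $r\geq 2$ and $k\geq 2$ be integers, let $d=rk$, and let $f:\overline{\mathbb{C}}\to\overline{\mathbb{C}}$ be a rational map of degree $d$ with exactly $3$ branching points, whose branching datum is $$\{\mu_1=[\alpha_1,\ldots,\alpha_A],\ \mu_2=[rx_1,\ldots,rx_B],\ \mu_3=[ry_1,\ldots,ry_C]\},$$ where the $\alpha_i$, $x_i$, $y_i$ are positive integers. Then there exist M\"obius transformations $\varphi,\psi:\overline{\mathbb{C}}\to\overline{\mathbb{C}}$ and a rational map $g:\overline{\mathbb{C}}\to\overline{\mathbb{C}}$ of degree $k$ such that $f=\varphi\circ g^{r}\circ\psi$, where $g^r$ denotes the $r$-th power $z\mapsto g(z)^r$, and such that the branching datum of $g$ is obtained as follows: there are $r$ partitions $\lambda_1,\ldots,\lambda_r$ of $k$ whose union (concatenation as multisets) is $[\alpha_1,\ldots,\alpha_A]$, and the branching datum of $g$ consists of $[x_1,\ldots,x_B]$, $[y_1,\ldots,y_C]$, $\lambda_1,\ldots,\lambda_r$, with every trivial partition $[1,\ldots,1]$ of $k$ deleted from this list.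
   Context: $\overline{\mathbb{C}}=\mathbb{C}\cup\{\infty\}$ is the Riemann sphere. Square brackets denote unordered lists with repetitions (multisets). For a non-constant rational map $h:\overline{\mathbb{C}}\to\overline{\mathbb{C}}$ of degree $d$ and $x\in\overline{\mathbb{C}}$, let $\mu(x)$ be the partition of $d$ formed by the local degrees (multiplicities) of $h$ at the points of $h^{-1}(x)$. The branching points of $h$ are the points $x$ of the target for which $\mu(x)$ is not the trivial partition $[1,\ldots,1]$, and the branching datum of $h$ is the collection (with repetitions) of the partitions $\mu(x)$ over all branching points $x$. *)

theory Defs
  imports
    "HOL-Complex_Analysis.Complex_Analysis"
    "HOL-Computational_Algebra.Computational_Algebra"
    "HOL-Library.Multiset"
begin

text \<open>
  The Riemann sphere as the one-point extension of the complex plane, with \<open>None\<close> as the point at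
  infinity (the same underlying set as \<open>Alexandroff_extension euclidean\<close>).
\<close>

type_synonym riemann_sphere = "complex option"

definition sphere_quotient :: "complex \<Rightarrow> complex \<Rightarrow> riemann_sphere" where
  "sphere_quotient a b = (if b = 0 then None else Some (a / b))"

text \<open>
  The self-map of the sphere given by \<open>p / q\<close>, for coprime \<open>p\<close> and \<open>q\<close>. The value at infinity is
  read off from the coefficients of degree \<open>max (degree p) (degree q)\<close>.
\<close>

fun rat_map :: "complex poly \<Rightarrow> complex poly \<Rightarrow> riemann_sphere \<Rightarrow> riemann_sphere" where
  "rat_map p q (Some z) = sphere_quotient (poly p z) (poly q z)"
| "rat_map p q None =
     (let n = max (degree p) (degree q) in sphere_quotient (coeff p n) (coeff q n))"

definition rational_map_of_degree :: "nat \<Rightarrow> (riemann_sphere \<Rightarrow> riemann_sphere) \<Rightarrow> bool" where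
  "rational_map_of_degree d h \<longleftrightarrow>
     (\<exists>p q. coprime p q \<and> q \<noteq> 0 \<and> max (degree p) (degree q) = d \<and> h = rat_map p q)"

definition moebius_transformation :: "(riemann_sphere \<Rightarrow> riemann_sphere) \<Rightarrow> bool" where
  "moebius_transformation h \<longleftrightarrow> (\<exists>a b c d. a * d - b * c \<noteq> 0 \<and> h = rat_map [:b, a:] [:d, c:])"

definition sphere_power :: "nat \<Rightarrow> riemann_sphere \<Rightarrow> riemann_sphere" where
  "sphere_power r = map_option (\<lambda>w. w ^ r)"

text \<open>
  \<open>sphere_param x\<close> is a local parametrisation sending \<open>0\<close> to \<open>x\<close>, and \<open>sphere_coord y\<close> is the
  inverse local coordinate, vanishing at \<open>y\<close>. The value of \<open>sphere_coord y\<close> at the single point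
  outside its chart domain (\<open>None\<close> for finite \<open>y\<close>, \<open>Some 0\<close> for \<open>y = None\<close>) is a dummy;
  it is irrelevant to the order of vanishing below, which only depends on the germ at \<open>y\<close>.
\<close>

fun sphere_param :: "riemann_sphere \<Rightarrow> complex \<Rightarrow> riemann_sphere" where
  "sphere_param (Some a) t = Some (a + t)"
| "sphere_param None t = (if t = 0 then None else Some (1 / t))"

fun sphere_coord :: "riemann_sphere \<Rightarrow> riemann_sphere \<Rightarrow> complex" where
  "sphere_coord (Some b) (Some w) = w - b"
| "sphere_coord (Some b) None = 0"
| "sphere_coord None (Some w) = 1 / w"
| "sphere_coord None None = 0"

text \<open>
  The order of vanishing at \<open>0\<close> of \<open>h\<close> in local coordinates centred at \<open>x\<close> and \<open>h x\<close>. It is a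
  positive integer whenever \<open>h\<close> is a non-constant rational map.
\<close>

definition local_degree :: "(riemann_sphere \<Rightarrow> riemann_sphere) \<Rightarrow> riemann_sphere \<Rightarrow> nat" where
  "local_degree h x = nat (zorder (\<lambda>t. sphere_coord (h x) (h (sphere_param x t))) 0)"

text \<open>
  Fibres and the set of branching points are finite for non-constant rational maps, so the uses of
  \<open>mset_set\<close> below are not degenerate there.
\<close>

definition fibre_partition ::
    "(riemann_sphere \<Rightarrow> riemann_sphere) \<Rightarrow> riemann_sphere \<Rightarrow> nat multiset" where
  "fibre_partition h x = image_mset (local_degree h) (mset_set (h -` {x}))"

definition trivial_partition :: "nat \<Rightarrow> nat multiset" where
  "trivial_partition d = replicate_mset d 1"

definition is_partition :: "nat \<Rightarrow> nat multiset \<Rightarrow> bool" where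
  "is_partition d \<mu> \<longleftrightarrow> (\<forall>m\<in>#\<mu>. m > 0) \<and> \<Sum>\<^sub># \<mu> = d"

text \<open>In the following two definitions \<open>d\<close> is the degree of \<open>h\<close>.\<close>

definition branching_points ::
    "nat \<Rightarrow> (riemann_sphere \<Rightarrow> riemann_sphere) \<Rightarrow> riemann_sphere set" where
  "branching_points d h = {x. fibre_partition h x \<noteq> trivial_partition d}"

definition branching_datum ::
    "nat \<Rightarrow> (riemann_sphere \<Rightarrow> riemann_sphere) \<Rightarrow> nat multiset multiset" where
  "branching_datum d h = image_mset (fibre_partition h) (mset_set (branching_points d h))"

end

theory Submission
  imports Defs "HOL-Computational_Algebra.Field_as_Ring"
begin

text \<open>
  Why the theorem holds. Moving three points by a Moebius transformation \<open>\<phi>\<close>, the map \<open>f\<close> becomes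
  \<open>\<phi> \<circ> F\<close>, where \<open>F\<close> has partition \<open>r x\<close> over \<open>0\<close>, \<open>r y\<close> over \<open>\<infinity>\<close> and \<open>\<alpha>\<close> over \<open>1\<close>. All zeros
  and poles of \<open>F = p / q\<close> then have multiplicity divisible by \<open>r\<close>, so that \<open>p\<close> and \<open>q\<close> are \<open>r\<close>-th
  powers of polynomials and \<open>F = g ^ r\<close>; the transformation \<open>\<psi>\<close> can be the identity. The power map
  \<open>w \<mapsto> w ^ r\<close> has local degree \<open>r\<close> at \<open>0\<close> and \<open>\<infinity>\<close> and local degree \<open>1\<close> elsewhere. Over \<open>0\<close> and
  \<open>\<infinity>\<close> this leaves \<open>x\<close> and \<open>y\<close> for \<open>g\<close>. The fibre of \<open>F\<close> over \<open>1\<close> is the disjoint union of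
  the fibres of \<open>g\<close> over the \<open>r\<close>-th roots of unity, which cuts \<open>\<alpha>\<close> into the \<open>r\<close> partitions
  \<open>\<lambda>\<^sub>i\<close>. Over every other point \<open>w\<close>, a ramified point of \<open>g\<close> would be a ramified point of \<open>F\<close> over
  \<open>w ^ r\<close>, which is not a branching point.

  To compute with local degrees algebraically, a polynomial of degree at most \<open>n\<close> is regarded as a
  binary form of degree \<open>n\<close>, so that \<open>\<infinity>\<close> is a point like any other: a polynomial \<open>R\<close> vanishes there
  to order \<open>n - degree R\<close>. The fibre of \<open>p / q\<close> over the point \<open>[u : v]\<close> is the zero divisor of the
  form \<open>v p - u q\<close>, and local degrees are the orders of vanishing of this form
  (\<open>local_degree_rat_map\<close>). That every fibre partition has sum \<open>n\<close> is then the fundamental theorem of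
  algebra (\<open>sum_form_order\<close>). A Moebius transformation of the target replaces \<open>p\<close>, \<open>q\<close> by another
  basis of their span and merely rescales the fibre forms (\<open>fibre_partition_moebius_comp\<close>). For the
  power map, the fibre forms over \<open>0\<close> and \<open>\<infinity>\<close> are raised to the \<open>r\<close>-th power, and otherwise
  \<open>p ^ r - (w q) ^ r\<close> is \<open>p - w q\<close> times a cofactor that does not vanish on the fibre over \<open>w\<close>
  (\<open>form_order_power_diff\<close>).
\<close>

section \<open>Homogeneous coordinates on the sphere\<close>

fun num_coord :: "riemann_sphere \<Rightarrow> complex" where
  "num_coord (Some b) = b"
| "num_coord None = 1"

fun den_coord :: "riemann_sphere \<Rightarrow> complex" where
  "den_coord (Some b) = 1"
| "den_coord None = 0"

lemma coords_nonzero: "num_coord y \<noteq> 0 \<or> den_coord y \<noteq> 0"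
  by (cases y) auto

lemma sphere_quotient_coords [simp]: "sphere_quotient (num_coord y) (den_coord y) = y"
  by (cases y) (auto simp: sphere_quotient_def)

lemma sphere_quotient_eq_iff:
  assumes "u \<noteq> 0 \<or> v \<noteq> 0"
  shows "sphere_quotient u v = y \<longleftrightarrow> den_coord y * u = num_coord y * v"
  using assms by (cases y) (auto simp: sphere_quotient_def field_simps)

lemma coords_proportional_iff:
  "den_coord y * num_coord y' = num_coord y * den_coord y' \<longleftrightarrow> y = y'"
  by (cases y; cases y') auto

lemma sphere_quotient_scale:
  "s \<noteq> 0 \<Longrightarrow> sphere_quotient (s * u) (s * v) = sphere_quotient u v"
  by (auto simp: sphere_quotient_def)

text \<open>
  Two pairs of homogeneous coordinates of a point differ by a nonzero factor. It is extracted here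
  because \<open>num_coord\<close> and \<open>den_coord\<close> are normalised, whereas linear maps produce arbitrary pairs.
\<close>

lemma sphere_quotient_coords_scale:
  assumes "u \<noteq> 0 \<or> v \<noteq> 0"
  obtains \<kappa> where "\<kappa> \<noteq> 0" "u = \<kappa> * num_coord (sphere_quotient u v)"
    "v = \<kappa> * den_coord (sphere_quotient u v)"
proof (cases "v = 0")
  case True
  then show thesis using assms that[of u] by (simp add: sphere_quotient_def)
next
  case False
  then show thesis using that[of v] by (simp add: sphere_quotient_def)
qed

section \<open>Polynomials as binary forms\<close>

text \<open>
  At \<open>None\<close> the form of degree \<open>n\<close> is evaluated at \<open>(1, 0)\<close>, which leaves only the coefficient of
  its top power.
\<close>

fun form_value :: "nat \<Rightarrow> complex poly \<Rightarrow> riemann_sphere \<Rightarrow> complex" where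
  "form_value n R (Some a) = poly R a"
| "form_value n R None = coeff R n"

fun form_order :: "nat \<Rightarrow> complex poly \<Rightarrow> riemann_sphere \<Rightarrow> nat" where
  "form_order n R (Some a) = order a R"
| "form_order n R None = n - degree R"

lemma form_order_pos_iff:
  assumes "R \<noteq> 0" "degree R \<le> n"
  shows "form_order n R x > 0 \<longleftrightarrow> form_value n R x = 0"
proof (cases x)
  case None
  show ?thesis
  proof (cases "degree R = n")
    case True
    then show ?thesis using assms None by auto
  next
    case False
    then show ?thesis using assms None by (auto intro: coeff_eq_0)
  qed
qed (use assms in \<open>auto simp: order_root\<close>)

lemma form_value_mult:
  assumes "degree R \<le> n" "degree S \<le> m"
  shows "form_value (n + m) (R * S) x = form_value n R x * form_value m S x"
proof (cases x)
  case None
  show ?thesis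
  proof (cases "degree R = n \<and> degree S = m")
    case True
    then show ?thesis using None by (auto simp: coeff_mult_degree_sum)
  next
    case False
    have "degree (R * S) \<le> degree R + degree S" by (rule degree_mult_le)
    then have "degree (R * S) < n + m" using False assms by linarith
    moreover have "coeff R n = 0 \<or> coeff S m = 0"
      using False assms by (meson coeff_eq_0 le_neq_implies_less)
    ultimately show ?thesis using None by (auto intro: coeff_eq_0)
  qed
qed auto

lemma form_value_power:
  assumes "degree R \<le> n"
  shows "form_value (n * m) (R ^ m) x = form_value n R x ^ m"
proof (induction m)
  case 0
  then show ?case by (cases x) auto
next
  case (Suc m)
  have "degree (R ^ m) \<le> n * m"
    using degree_power_le[of R m] assms by (meson le_trans mult_le_mono1)
  then show ?case
    using form_value_mult[OF assms, of "R ^ m" "n * m"] Suc by simp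
qed

lemma form_value_sum: "form_value n (\<Sum>i\<in>I. R i) x = (\<Sum>i\<in>I. form_value n (R i) x)"
  by (cases x) (auto simp: poly_sum coeff_sum)

lemma form_order_mult:
  assumes "R \<noteq> 0" "S \<noteq> 0" "degree R \<le> n" "degree S \<le> m"
  shows "form_order (n + m) (R * S) x = form_order n R x + form_order m S x"
  using assms by (cases x) (auto simp: order_mult degree_mult_eq)

lemma form_order_power:
  assumes "R \<noteq> 0"
  shows "form_order (n * m) (R ^ m) x = m * form_order n R x"
proof (cases x)
  case (Some a)
  have "order a (R ^ m) = m * order a R"
    using assms by (induction m) (auto simp: order_mult)
  then show ?thesis using Some by simp
qed (auto simp: degree_power_eq assms algebra_simps)

lemma form_order_smult: "s \<noteq> 0 \<Longrightarrow> form_order n (smult s R) x = form_order n R x"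
  by (cases x) (auto simp: order_smult)

lemma form_order_minus: "form_order n (- R) x = form_order n R x"
  using form_order_smult[of "-1" n R x] by simp

lemma form_zeros_subset:
  "{x. form_order n R x > 0} \<subseteq> insert None (Some ` {a. poly R a = 0})"
proof
  fix x assume "x \<in> {x. form_order n R x > 0}"
  then show "x \<in> insert None (Some ` {a. poly R a = 0})"
    by (cases x) (auto simp: order_root)
qed

lemma finite_form_zeros:
  assumes "R \<noteq> 0"
  shows "finite {x. form_order n R x > 0}"
  by (rule finite_subset[OF form_zeros_subset]) (use assms poly_roots_finite in auto)

text \<open>
  A nonzero form of degree \<open>n\<close> has \<open>n\<close> zeros on the sphere: the polynomial has \<open>degree R\<close> finite
  roots, and the missing \<open>n - degree R\<close> zeros lie at infinity.
\<close>

lemma sum_form_order: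
  assumes "R \<noteq> 0" "degree R \<le> n"
  shows "(\<Sum>x | form_order n R x > 0. form_order n R x) = n"
proof -
  let ?Z = "{a. poly R a = 0}"
  have fin: "finite ?Z" using assms poly_roots_finite by blast
  have "(\<Sum>x | form_order n R x > 0. form_order n R x) =
        (\<Sum>x\<in>insert None (Some ` ?Z). form_order n R x)"
    using form_zeros_subset fin by (intro sum.mono_neutral_left) auto
  also have "\<dots> = (n - degree R) + (\<Sum>a\<in>?Z. order a R)"
    using fin by (subst sum.insert) (auto simp: sum.reindex)
  also have "(\<Sum>a\<in>?Z. order a R) = size (proots R)"
    using assms by (simp add: size_multiset_overloaded_eq)
  finally show ?thesis using assms by (simp add: size_proots_complex)
qed

section \<open>Fibres and local degrees of a rational map\<close>

definition reduced_fraction :: "nat \<Rightarrow> complex poly \<Rightarrow> complex poly \<Rightarrow> bool" where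
  "reduced_fraction n p q \<longleftrightarrow> coprime p q \<and> max (degree p) (degree q) = n \<and> n > 0"

text \<open>
  The fibre of \<open>p / q\<close> over \<open>y = [u : v]\<close> is cut out by \<open>p / q = u / v\<close> with denominators cleared,
  an equation that makes sense for \<open>y = \<infinity>\<close> too.
\<close>

definition fibre_form :: "complex poly \<Rightarrow> complex poly \<Rightarrow> riemann_sphere \<Rightarrow> complex poly" where
  "fibre_form p q y = smult (den_coord y) p - smult (num_coord y) q"

lemma rat_map_conv_form_value:
  assumes "reduced_fraction n p q"
  shows "rat_map p q x = sphere_quotient (form_value n p x) (form_value n q x)"
  using assms by (cases x) (auto simp: Let_def reduced_fraction_def)

lemma form_values_nonzero:
  assumes "reduced_fraction n p q"
  shows "form_value n p x \<noteq> 0 \<or> form_value n q x \<noteq> 0"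
proof (cases x)
  case None
  have "degree p = n \<or> degree q = n" using assms by (auto simp: reduced_fraction_def max_def)
  then show ?thesis using assms None by (auto simp: reduced_fraction_def)
next
  case (Some a)
  then show ?thesis using assms coprime_poly_0[of p q a] by (auto simp: reduced_fraction_def)
qed

text \<open>
  A vanishing fibre form would make \<open>p\<close> and \<open>q\<close> proportional, which for coprime polynomials means
  that the map is constant.
\<close>

lemma fibre_form_nonzero:
  assumes "reduced_fraction n p q"
  shows "fibre_form p q y \<noteq> 0"
proof
  assume *: "fibre_form p q y = 0"
  show False
  proof (cases y)
    case None
    then have "q = 0" using * by (simp add: fibre_form_def)
    then have "is_unit p" using assms by (simp add: reduced_fraction_def)
    then have "degree p = 0" by (auto elim: is_unit_polyE)
    then show False using assms \<open>q = 0\<close> by (auto simp: reduced_fraction_def)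
  next
    case (Some b)
    then have p: "p = smult b q" using * by (simp add: fibre_form_def)
    then have "q dvd p" by (simp add: dvd_smult)
    then have "is_unit q" using assms by (meson coprime_common_divisor dvd_refl reduced_fraction_def)
    then have "degree q = 0" by (auto elim: is_unit_polyE)
    then show False using assms p by (auto simp: reduced_fraction_def split: if_splits)
  qed
qed

lemma degree_fibre_form_le:
  assumes "reduced_fraction n p q"
  shows "degree (fibre_form p q y) \<le> n"
  using assms unfolding fibre_form_def reduced_fraction_def
  by (intro degree_diff_le order_trans[OF degree_smult_le]) auto

lemma form_value_fibre_form:
  "form_value n (fibre_form p q y) x =
     den_coord y * form_value n p x - num_coord y * form_value n q x"
  by (cases x) (auto simp: fibre_form_def)

lemma rat_map_eq_iff:
  assumes "reduced_fraction n p q"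
  shows "rat_map p q x = y \<longleftrightarrow> form_order n (fibre_form p q y) x > 0"
  using form_values_nonzero[OF assms, of x]
  by (simp add: rat_map_conv_form_value[OF assms] sphere_quotient_eq_iff
      form_order_pos_iff[OF fibre_form_nonzero degree_fibre_form_le, OF assms assms]
      form_value_fibre_form)

lemma vimage_rat_map:
  assumes "reduced_fraction n p q"
  shows "rat_map p q -` {y} = {x. form_order n (fibre_form p q y) x > 0}"
  using rat_map_eq_iff[OF assms] by auto

text \<open>
  Only the values of \<open>f\<close> off the zeros of \<open>S\<close> and away from \<open>0\<close> are prescribed, because a map read
  in the charts of the sphere takes dummy values at points outside the chart.
\<close>

lemma zorder_poly_quotient:
  fixes R S :: "complex poly"
  assumes "R \<noteq> 0" "poly S a \<noteq> 0"
    and f: "\<And>t. t \<noteq> 0 \<Longrightarrow> poly S (a + t) \<noteq> 0 \<Longrightarrow> f t = poly R (a + t) / poly S (a + t)"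
  shows "zorder f 0 = int (order a R)"
proof -
  obtain T where R: "R = [:- a, 1:] ^ order a R * T" and T: "\<not> [:- a, 1:] dvd T"
    using order_decomp[OF assms(1)] by blast
  define U where "U = {t. poly S (a + t) \<noteq> 0}"
  have "open U" unfolding U_def by (intro open_Collect_neq continuous_intros)
  moreover have "(\<lambda>t. poly T (a + t) / poly S (a + t)) holomorphic_on U"
    unfolding U_def by (intro holomorphic_intros) auto
  moreover have "f w = poly T (a + w) / poly S (a + w) * (w - 0) powi int (order a R)"
    if "w \<in> U" "w \<noteq> 0" for w
  proof -
    have "poly R (a + w) = w ^ order a R * poly T (a + w)"
      by (subst R) (simp add: poly_power)
    then show ?thesis using that f[of w] by (simp add: U_def)
  qed
  ultimately show ?thesis
    using assms(2) T
    by (intro zorder_eqI[where S = U and g = "\<lambda>t. poly T (a + t) / poly S (a + t)"])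
      (auto simp: U_def poly_eq_0_iff_dvd)
qed

text \<open>
  In the coordinate \<open>t = 1 / z\<close> the polynomial \<open>R\<close> becomes its reflection divided by \<open>t ^ degree R\<close>,
  and a reflection does not vanish at \<open>0\<close>. The order is therefore the difference of the degrees.
\<close>

lemma zorder_poly_quotient_at_infinity:
  fixes R S :: "complex poly"
  assumes "R \<noteq> 0" "S \<noteq> 0" "degree R \<le> degree S"
    and f: "\<And>t. t \<noteq> 0 \<Longrightarrow> poly S (1 / t) \<noteq> 0 \<Longrightarrow> f t = poly R (1 / t) / poly S (1 / t)"
  shows "zorder f 0 = int (degree S - degree R)"
proof -
  define U where "U = {t. poly (reflect_poly S) t \<noteq> 0}"
  have "open U" unfolding U_def by (intro open_Collect_neq continuous_intros)
  moreover have "(\<lambda>t. poly (reflect_poly R) t / poly (reflect_poly S) t) holomorphic_on U"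
    unfolding U_def by (intro holomorphic_intros) auto
  moreover have "f w = poly (reflect_poly R) w / poly (reflect_poly S) w *
      (w - 0) powi int (degree S - degree R)" if "w \<in> U" "w \<noteq> 0" for w
  proof -
    have "poly S (1 / w) \<noteq> 0"
      using that by (auto simp: U_def poly_reflect_poly_nz inverse_eq_divide)
    moreover have "w ^ degree S = w ^ degree R * w ^ (degree S - degree R)"
      using assms(3) by (simp add: power_add [symmetric])
    ultimately show ?thesis
      using that f[of w] by (simp add: poly_reflect_poly_nz inverse_eq_divide)
  qed
  ultimately show ?thesis
    using assms(1,2)
    by (intro zorder_eqI[where S = U
          and g = "\<lambda>t. poly (reflect_poly R) t / poly (reflect_poly S) t"])
      (auto simp: U_def)
qed

text \<open>
  In the chart centred at \<open>y = h x\<close> the map \<open>h = p / q\<close> reads \<open>(p - y q) / q\<close> if \<open>y\<close> is finite and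
  \<open>q / p\<close> otherwise. The numerator is the fibre form up to sign, and the denominator, as a form, does
  not vanish at \<open>x\<close>, so it contributes nothing to the order.
\<close>

lemma local_degree_rat_map:
  assumes "reduced_fraction n p q"
  shows "local_degree (rat_map p q) x = form_order n (fibre_form p q (rat_map p q x)) x"
proof -
  define y where "y = rat_map p q x"
  \<comment> \<open>The sign matches the fibre form over infinity, which is \<open>- q\<close>.\<close>
  define S where "S = (if y = None then - p else q)"
  define R where "R = fibre_form p q y"
  let ?f = "\<lambda>t. sphere_coord y (rat_map p q (sphere_param x t))"
  have R0: "R \<noteq> 0" "degree R \<le> n"
    unfolding R_def using fibre_form_nonzero degree_fibre_form_le assms by auto
  have coord: "sphere_coord y (sphere_quotient (poly p z) (poly q z)) = poly R z / poly S z"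
    if "poly S z \<noteq> 0" for z
    using that by (cases y)
      (auto simp: R_def S_def fibre_form_def sphere_quotient_def field_simps)
  have "form_value n S x \<noteq> 0"
    using form_values_nonzero[OF assms, of x] rat_map_conv_form_value[OF assms, of x]
    by (cases x) (auto simp: y_def S_def sphere_quotient_def split: if_splits)
  have "zorder ?f 0 = int (form_order n R x)"
  proof (cases x)
    case None
    have "degree S \<le> n" using assms by (auto simp: S_def reduced_fraction_def)
    moreover have "coeff S n \<noteq> 0" using \<open>form_value n S x \<noteq> 0\<close> None by simp
    ultimately have "degree S = n" "S \<noteq> 0" by (auto intro: antisym le_degree)
    then show ?thesis
      using zorder_poly_quotient_at_infinity[of R S ?f] R0 coord None by simp
  next
    case (Some a)
    then show ?thesis
      using zorder_poly_quotient[of R S a ?f] R0 coord \<open>form_value n S x \<noteq> 0\<close> by simp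
  qed
  then show ?thesis by (simp add: local_degree_def R_def y_def)
qed

lemma fibre_partition_rat_map:
  assumes "reduced_fraction n p q"
  shows "fibre_partition (rat_map p q) y =
    image_mset (form_order n (fibre_form p q y))
      (mset_set {x. form_order n (fibre_form p q y) x > 0})"
proof -
  have "finite {x. form_order n (fibre_form p q y) x > 0}"
    using fibre_form_nonzero[OF assms] by (rule finite_form_zeros)
  then show ?thesis
    unfolding fibre_partition_def vimage_rat_map[OF assms, symmetric]
    by (intro image_mset_cong) (simp add: local_degree_rat_map[OF assms])
qed

lemma finite_fibre:
  assumes "reduced_fraction n p q"
  shows "finite (rat_map p q -` {y})"
  unfolding vimage_rat_map[OF assms]
  using fibre_form_nonzero[OF assms] by (rule finite_form_zeros)

lemma is_partition_fibre_partition: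
  assumes "reduced_fraction n p q"
  shows "is_partition n (fibre_partition (rat_map p q) y)"
proof -
  have "finite {x. form_order n (fibre_form p q y) x > 0}"
    using fibre_form_nonzero[OF assms] by (rule finite_form_zeros)
  then show ?thesis
    using sum_form_order[OF fibre_form_nonzero degree_fibre_form_le, OF assms assms]
    unfolding is_partition_def fibre_partition_rat_map[OF assms]
    by (auto simp: sum_unfold_sum_mset)
qed

section \<open>Composition with a Moebius transformation\<close>

lemma moebius_sphere_quotient:
  assumes "a * e - b * c \<noteq> 0" "u \<noteq> 0 \<or> v \<noteq> 0"
  shows "rat_map [:b, a:] [:e, c:] (sphere_quotient u v) =
    sphere_quotient (a * u + b * v) (c * u + e * v)"
proof (cases "v = 0")
  case True
  have "max (degree [:b, a:]) (degree [:e, c:]) = 1" using assms by auto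
  then show ?thesis
    using True assms sphere_quotient_scale[of u a c]
    by (simp add: sphere_quotient_def mult.commute)
next
  case False
  have "rat_map [:b, a:] [:e, c:] (sphere_quotient u v) =
      sphere_quotient (b + u / v * a) (e + u / v * c)"
    using False by (simp add: sphere_quotient_def)
  also have "\<dots> = sphere_quotient (v * (b + u / v * a)) (v * (e + u / v * c))"
    using False by (simp add: sphere_quotient_scale)
  also have "\<dots> = sphere_quotient (a * u + b * v) (c * u + e * v)"
    using False by (simp add: algebra_simps)
  finally show ?thesis .
qed

lemma linear_change_nonzero:
  fixes a b c e u v :: complex
  assumes "a * e - b * c \<noteq> 0" "u \<noteq> 0 \<or> v \<noteq> 0"
  shows "a * u + b * v \<noteq> 0 \<or> c * u + e * v \<noteq> 0"
proof (rule ccontr)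
  assume "\<not> ?thesis"
  then have *: "a * u + b * v = 0" "c * u + e * v = 0" by auto
  have "(a * e - b * c) * u = e * (a * u + b * v) - b * (c * u + e * v)"
       "(a * e - b * c) * v = a * (c * u + e * v) - c * (a * u + b * v)"
    by (simp_all add: algebra_simps)
  then show False using assms unfolding * by simp
qed

lemma inj_moebius:
  assumes "a * e - b * c \<noteq> 0"
  shows "inj (rat_map [:b, a:] [:e, c:])"
proof (rule inj_on_inverseI)
  fix w
  let ?u = "a * num_coord w + b * den_coord w" and ?v = "c * num_coord w + e * den_coord w"
  have D': "e * a - (- b) * (- c) \<noteq> 0" using assms by (simp add: mult.commute)
  have "rat_map [:b, a:] [:e, c:] w = sphere_quotient ?u ?v"
    using moebius_sphere_quotient[OF assms coords_nonzero, of w] by simp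
  then have "rat_map [:- b, e:] [:a, - c:] (rat_map [:b, a:] [:e, c:] w) =
      sphere_quotient (e * ?u + (- b) * ?v) ((- c) * ?u + a * ?v)"
    using moebius_sphere_quotient[OF D' linear_change_nonzero[OF assms coords_nonzero]] by metis
  also have "\<dots> = sphere_quotient ((a * e - b * c) * num_coord w) ((a * e - b * c) * den_coord w)"
    by (simp add: algebra_simps)
  also have "\<dots> = w" using assms by (simp add: sphere_quotient_scale)
  finally show "rat_map [:- b, e:] [:a, - c:] (rat_map [:b, a:] [:e, c:] w) = w" .
qed

text \<open>
  The old pair is recovered from the new one by the adjugate matrix, up to the determinant; hence
  common divisors and degree bounds pass in both directions.
\<close>

lemma reduced_fraction_linear_change:
  assumes "reduced_fraction n p q" "a * e - b * c \<noteq> 0"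
  shows "reduced_fraction n (smult a p + smult b q) (smult c p + smult e q)"
    (is "reduced_fraction n ?p ?q")
proof -
  define D where "D = a * e - b * c"
  have D: "D \<noteq> 0" using assms by (simp add: D_def)
  have p: "smult D p = smult e ?p - smult b ?q"
    and q: "smult D q = smult a ?q - smult c ?p"
    by (simp_all add: D_def smult_add_right smult_diff_left algebra_simps)
  have "coprime ?p ?q"
  proof (rule coprimeI)
    fix t assume t: "t dvd ?p" "t dvd ?q"
    have "t dvd smult D p" unfolding p by (intro dvd_diff dvd_smult t)
    moreover have "t dvd smult D q" unfolding q by (intro dvd_diff dvd_smult t)
    ultimately show "is_unit t"
      using assms D by (auto simp: dvd_smult_iff reduced_fraction_def intro: coprime_common_divisor)
  qed
  moreover have "max (degree ?p) (degree ?q) = n"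
  proof (rule antisym)
    have "degree p \<le> n" "degree q \<le> n" using assms by (auto simp: reduced_fraction_def)
    then show "max (degree ?p) (degree ?q) \<le> n"
      by (intro max.boundedI degree_add_le order_trans[OF degree_smult_le])
    have "degree (smult D p) \<le> max (degree ?p) (degree ?q)"
      unfolding p by (intro degree_diff_le order_trans[OF degree_smult_le]) auto
    moreover have "degree (smult D q) \<le> max (degree ?p) (degree ?q)"
      unfolding q by (intro degree_diff_le order_trans[OF degree_smult_le]) auto
    ultimately show "n \<le> max (degree ?p) (degree ?q)"
      using assms D by (auto simp: reduced_fraction_def)
  qed
  ultimately show ?thesis using assms by (simp add: reduced_fraction_def)
qed

lemma rat_map_linear_change:
  assumes "reduced_fraction n p q" "a * e - b * c \<noteq> 0"
  shows "rat_map (smult a p + smult b q) (smult c p + smult e q) =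
    rat_map [:b, a:] [:e, c:] \<circ> rat_map p q"
proof
  fix x
  have "form_value n (smult s p + smult t q) x = s * form_value n p x + t * form_value n q x" for s t
    by (cases x) auto
  then show "rat_map (smult a p + smult b q) (smult c p + smult e q) x =
      (rat_map [:b, a:] [:e, c:] \<circ> rat_map p q) x"
    using form_values_nonzero[OF assms(1), of x] assms(2)
    by (simp add: rat_map_conv_form_value[OF assms(1)] moebius_sphere_quotient
        rat_map_conv_form_value[OF reduced_fraction_linear_change[OF assms]])
qed

lemma rat_map_factors_through_moebius:
  assumes "reduced_fraction n p q" "a * e - b * c \<noteq> 0"
  obtains p' q' where "reduced_fraction n p' q'"
    "rat_map p q = rat_map [:b, a:] [:e, c:] \<circ> rat_map p' q'"
proof -
  define D where "D = a * e - b * c"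
  have D: "D \<noteq> 0" using assms by (simp add: D_def)
  define p' where "p' = smult (e / D) p + smult (- b / D) q"
  define q' where "q' = smult (- c / D) p + smult (a / D) q"
  have "e / D * (a / D) - - b / D * (- c / D) = (a * e - b * c) / (D * D)"
    by (simp add: diff_divide_distrib mult.commute)
  then have "e / D * (a / D) - - b / D * (- c / D) \<noteq> 0"
    using D by (simp flip: D_def)
  then have pq': "reduced_fraction n p' q'"
    unfolding p'_def q'_def by (rule reduced_fraction_linear_change[OF assms(1)])
  have Dp': "D * coeff p' i = e * coeff p i - b * coeff q i"
    and Dq': "D * coeff q' i = a * coeff q i - c * coeff p i" for i
    using D by (simp_all add: p'_def q'_def field_simps)
  have "D * (a * coeff p' i + b * coeff q' i) = D * coeff p i"
    "D * (c * coeff p' i + e * coeff q' i) = D * coeff q i" for i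
    unfolding distrib_left mult.left_commute[of D] Dp' Dq'
    by (simp_all add: D_def algebra_simps)
  then have "smult a p' + smult b q' = p" "smult c p' + smult e q' = q"
    using D by (simp_all add: poly_eq_iff)
  then show thesis
    using that[OF pq'] rat_map_linear_change[OF pq' assms(2)] by metis
qed

text \<open>
  The matrix acts on the pair of polynomials and on the coordinates of the target point alike, so the
  fibre form, which is a determinant in these two pairs, is multiplied by a nonzero constant.
\<close>

lemma fibre_partition_moebius_comp:
  assumes "reduced_fraction n p q" "a * e - b * c \<noteq> 0"
  defines "\<phi> \<equiv> rat_map [:b, a:] [:e, c:]"
  shows "fibre_partition (\<phi> \<circ> rat_map p q) (\<phi> y) = fibre_partition (rat_map p q) y"
proof -
  let ?p = "smult a p + smult b q" and ?q = "smult c p + smult e q"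
  define u where "u = a * num_coord y + b * den_coord y"
  define v where "v = c * num_coord y + e * den_coord y"
  have "u \<noteq> 0 \<or> v \<noteq> 0"
    unfolding u_def v_def by (rule linear_change_nonzero[OF assms(2) coords_nonzero])
  then obtain \<kappa> where \<kappa>: "\<kappa> \<noteq> 0" "u = \<kappa> * num_coord (sphere_quotient u v)"
    "v = \<kappa> * den_coord (sphere_quotient u v)"
    by (rule sphere_quotient_coords_scale)
  have "\<phi> y = sphere_quotient u v"
    using moebius_sphere_quotient[OF assms(2) coords_nonzero, of y]
    by (simp add: \<phi>_def u_def v_def)
  then have \<kappa>': "u = \<kappa> * num_coord (\<phi> y)" "v = \<kappa> * den_coord (\<phi> y)"
    using \<kappa> by simp_all
  have "smult \<kappa> (fibre_form ?p ?q (\<phi> y)) = smult v ?p - smult u ?q"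
    by (simp add: fibre_form_def \<kappa>' smult_diff_right)
  also have "\<dots> = smult (a * e - b * c) (fibre_form p q y)"
    by (rule poly_eqI) (simp add: fibre_form_def u_def v_def algebra_simps)
  finally have "form_order n (fibre_form ?p ?q (\<phi> y)) = form_order n (fibre_form p q y)"
    using \<kappa>(1) assms(2) form_order_smult by (intro ext) metis
  then show ?thesis
    unfolding \<phi>_def rat_map_linear_change[OF assms(1,2), symmetric]
      fibre_partition_rat_map[OF assms(1)]
      fibre_partition_rat_map[OF reduced_fraction_linear_change[OF assms(1,2)]]
    by simp
qed

text \<open>
  The columns of the matrix are coordinate vectors of \<open>P3\<close> and \<open>P2\<close>. Cramer's rule gives the
  factors \<open>l\<close>, \<open>m\<close> by which to scale them so that their sum represents \<open>P1\<close>, the image of \<open>1\<close>.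
\<close>

lemma moebius_through_three_points:
  assumes "P1 \<noteq> P2" "P1 \<noteq> P3" "P2 \<noteq> P3"
  obtains a b c e where "a * e - b * c \<noteq> 0"
    "rat_map [:b, a:] [:e, c:] (Some 0) = P2"
    "rat_map [:b, a:] [:e, c:] None = P3"
    "rat_map [:b, a:] [:e, c:] (Some 1) = P1"
proof -
  let ?det = "\<lambda>y y'. den_coord y * num_coord y' - num_coord y * den_coord y'"
  have det: "?det y y' \<noteq> 0" if "y \<noteq> y'" for y y'
    using that coords_proportional_iff[of y y'] by auto
  define l where "l = ?det P2 P1"
  define m where "m = ?det P1 P3"
  define a where "a = l * num_coord P3"
  define b where "b = m * num_coord P2"
  define c where "c = l * den_coord P3"
  define e where "e = m * den_coord P2"
  have lm: "l \<noteq> 0" "m \<noteq> 0" unfolding l_def m_def using assms det by metis+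
  have "a * e - b * c = l * m * ?det P2 P3"
    by (simp add: a_def b_def c_def e_def algebra_simps)
  then have D: "a * e - b * c \<noteq> 0" using lm det[OF assms(3)] by simp
  have "a + b = ?det P2 P3 * num_coord P1" "c + e = ?det P2 P3 * den_coord P1"
    by (simp_all add: a_def b_def c_def e_def l_def m_def algebra_simps)
  then have "sphere_quotient (a + b) (c + e) = P1"
    using det[OF assms(3)] by (simp add: sphere_quotient_scale)
  moreover have "sphere_quotient b e = P2" "sphere_quotient a c = P3"
    using lm by (simp_all add: a_def b_def c_def e_def sphere_quotient_scale)
  ultimately show thesis
    using that[OF D] moebius_sphere_quotient[OF D, of 0 1] moebius_sphere_quotient[OF D, of 1 0]
      moebius_sphere_quotient[OF D, of 1 1]
    by (simp add: sphere_quotient_def)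
qed

section \<open>Composition with a power map\<close>

lemma reduced_fraction_power:
  assumes "reduced_fraction n p q" "r > 0"
  shows "reduced_fraction (n * r) (p ^ r) (q ^ r)"
proof -
  have "degree (R ^ r) = degree R * r" for R :: "complex poly"
    using assms(2) by (cases "R = 0") (auto simp: degree_power_eq power_0_left)
  then show ?thesis
    using assms by (auto simp: reduced_fraction_def max_def)
qed

lemma reduced_fraction_of_power:
  assumes "reduced_fraction (r * n) (p ^ r) (q ^ r)"
  shows "reduced_fraction n p q"
proof -
  have r: "r > 0" "n > 0" using assms by (auto simp: reduced_fraction_def)
  have "degree (R ^ r) = r * degree R" for R :: "complex poly"
    using r by (cases "R = 0") (auto simp: degree_power_eq power_0_left)
  then have "r * max (degree p) (degree q) = r * n"
    using assms by (simp add: reduced_fraction_def nat_mult_max_right)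
  then show ?thesis using assms r by (simp add: reduced_fraction_def)
qed

lemma rat_map_power:
  assumes "reduced_fraction n p q" "r > 0"
  shows "rat_map (p ^ r) (q ^ r) x = sphere_power r (rat_map p q x)"
proof -
  have "degree p \<le> n" "degree q \<le> n" using assms by (auto simp: reduced_fraction_def)
  then show ?thesis
    using assms(2)
    by (simp add: rat_map_conv_form_value[OF assms(1)] form_value_power
        rat_map_conv_form_value[OF reduced_fraction_power[OF assms]])
      (auto simp: sphere_quotient_def sphere_power_def power_divide)
qed

text \<open>
  In \<open>R ^ r - S ^ r = (R - S) T\<close> each of the \<open>r\<close> summands of the cofactor \<open>T\<close> takes the same value
  \<open>v ^ (r - 1)\<close> at a point where \<open>R\<close> and \<open>S\<close> have the common value \<open>v\<close>. In characteristic zero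
  their sum is nonzero, so \<open>T\<close> does not change the order.
\<close>

lemma form_order_power_diff:
  assumes "degree R \<le> n" "degree S \<le> n" "R \<noteq> S" "r > 0"
    and "form_value n R x = form_value n S x" "form_value n S x \<noteq> 0"
  shows "form_order (n * r) (R ^ r - S ^ r) x = form_order n (R - S) x"
proof -
  obtain m where m: "r = Suc m" using assms(4) by (cases r) auto
  define T where "T = (\<Sum>i<r. S ^ (r - Suc i) * R ^ i)"
  have deg: "degree (A ^ i) \<le> n * i" if "degree A \<le> n" for A :: "complex poly" and i
    using degree_power_le[of A i] that by (meson le_trans mult_le_mono1)
  have split: "n * m = n * (r - Suc i) + n * i" if "i < r" for i
    using that m by (simp add: add_mult_distrib2 [symmetric])
  have "degree T \<le> n * m"
    unfolding T_def
  proof (rule degree_sum_le)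
    fix i assume "i \<in> {..<r}"
    then show "degree (S ^ (r - Suc i) * R ^ i) \<le> n * m"
      using deg[OF assms(1), of i] deg[OF assms(2), of "r - Suc i"] split[of i]
        degree_mult_le[of "S ^ (r - Suc i)" "R ^ i"] by simp
  qed simp
  moreover have "form_value (n * m) T x = of_nat r * form_value n S x ^ m"
  proof -
    have "form_value (n * m) T x = (\<Sum>i<r. form_value n S x ^ m)"
      unfolding T_def form_value_sum
    proof (rule sum.cong)
      fix i assume "i \<in> {..<r}"
      then have i: "i < r" by simp
      then have "r - Suc i + i = m" using m by simp
      then show "form_value (n * m) (S ^ (r - Suc i) * R ^ i) x = form_value n S x ^ m"
        using assms(1,2,5)
        by (simp add: split[OF i] form_value_mult deg form_value_power power_add [symmetric])
    qed simp
    then show ?thesis by simp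
  qed
  ultimately have "T \<noteq> 0" and "form_order (n * m) T x = 0"
    using assms(4,6) form_order_pos_iff[of T "n * m" x] by (cases "T = 0"; cases x; force)+
  then have "form_order (n + n * m) ((R - S) * T) x = form_order n (R - S) x"
    using assms \<open>degree T \<le> n * m\<close> by (subst form_order_mult) (auto intro: degree_diff_le)
  moreover have "R ^ r - S ^ r = (R - S) * T"
    unfolding T_def by (rule power_diff_sumr2)
  ultimately show ?thesis by (simp add: m)
qed

lemma local_degree_power_ramified:
  assumes "reduced_fraction n p q" "r > 0" "rat_map p q x \<in> {Some 0, None}"
  shows "local_degree (rat_map (p ^ r) (q ^ r)) x = r * local_degree (rat_map p q) x"
proof -
  have "p \<noteq> 0" if "rat_map p q x = Some 0"
    using fibre_form_nonzero[OF assms(1), of "Some 0"] by (simp add: fibre_form_def)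
  moreover have "q \<noteq> 0"
    using fibre_form_nonzero[OF assms(1), of None] by (simp add: fibre_form_def)
  ultimately show ?thesis
    using assms(2,3)
    by (auto simp: local_degree_rat_map[OF assms(1)] rat_map_power[OF assms(1,2)]
        local_degree_rat_map[OF reduced_fraction_power[OF assms(1,2)]]
        fibre_form_def sphere_power_def form_order_power form_order_minus power_0_left)
qed

lemma local_degree_power_unramified:
  assumes "reduced_fraction n p q" "r > 0" "rat_map p q x = Some w" "w \<noteq> 0"
  shows "local_degree (rat_map (p ^ r) (q ^ r)) x = local_degree (rat_map p q) x"
proof -
  have deg: "degree p \<le> n" "degree (smult w q) \<le> n"
    using assms(1,4) by (auto simp: reduced_fraction_def)
  have ff: "fibre_form p q (Some w) = p - smult w q"
    by (simp add: fibre_form_def)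
  have val: "form_value n (smult w q) x = w * form_value n q x" by (cases x) auto
  have eq: "form_value n p x = w * form_value n q x"
    using assms(3) form_values_nonzero[OF assms(1), of x]
    by (simp add: rat_map_conv_form_value[OF assms(1)] sphere_quotient_eq_iff)
  then have "w * form_value n q x \<noteq> 0"
    using assms(4) form_values_nonzero[OF assms(1), of x] by auto
  then have "form_order (n * r) (p ^ r - smult w q ^ r) x = form_order n (p - smult w q) x"
    using fibre_form_nonzero[OF assms(1), of "Some w"] deg val eq assms(2)
    by (intro form_order_power_diff) (auto simp: ff)
  then show ?thesis
    using assms(3)
    by (simp add: local_degree_rat_map[OF assms(1)] rat_map_power[OF assms(1,2)] ff
        local_degree_rat_map[OF reduced_fraction_power[OF assms(1,2)]]
        fibre_form_def sphere_power_def smult_power)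
qed

lemma fibre_partition_power_ramified:
  assumes "reduced_fraction n p q" "r > 0" "y \<in> {Some 0, None}"
  shows "fibre_partition (rat_map (p ^ r) (q ^ r)) y =
    image_mset ((*) r) (fibre_partition (rat_map p q) y)"
proof -
  have "rat_map (p ^ r) (q ^ r) -` {y} = rat_map p q -` {y}"
    using assms(2,3) by (auto simp: rat_map_power[OF assms(1,2)] sphere_power_def)
  then show ?thesis
    using assms(3) finite_fibre[OF assms(1), of y]
    by (auto simp: fibre_partition_def multiset.map_comp o_def
        intro!: image_mset_cong local_degree_power_ramified[OF assms(1,2)])
qed

text \<open>
  The fibre is the disjoint union of the fibres of \<open>p / q\<close> over the \<open>r\<close>-th roots of \<open>w\<close>, and local
  degrees agree since the power map is unramified away from \<open>0\<close> and \<open>\<infinity>\<close>.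
\<close>

lemma fibre_partition_power_unramified:
  assumes "reduced_fraction n p q" "r > 0" "w \<noteq> 0"
  shows "fibre_partition (rat_map (p ^ r) (q ^ r)) (Some w) =
    (\<Sum>z | z ^ r = w. fibre_partition (rat_map p q) (Some z))"
proof -
  let ?F = "rat_map (p ^ r) (q ^ r)" and ?g = "rat_map p q"
  have fibre: "?F -` {Some w} = (\<Union>z\<in>{z. z ^ r = w}. ?g -` {Some z})"
    by (auto simp: rat_map_power[OF assms(1,2)] sphere_power_def)
  have "image_mset (local_degree ?F) (mset_set (\<Union>z\<in>Z. ?g -` {Some z})) =
      (\<Sum>z\<in>Z. fibre_partition ?g (Some z))" if "finite Z" "0 \<notin> Z" for Z
    using that
  proof (induction Z)
    case (insert z Z)
    have "image_mset (local_degree ?F) (mset_set (?g -` {Some z})) = fibre_partition ?g (Some z)"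
      unfolding fibre_partition_def using insert.prems finite_fibre[OF assms(1)]
      by (intro image_mset_cong local_degree_power_unramified[OF assms(1,2)]) auto
    then show ?case
      using insert finite_fibre[OF assms(1)]
      by (subst UN_insert, subst mset_set_Union) auto
  qed auto
  then show ?thesis
    using assms(2,3) finite_nth_roots[of r w] unfolding fibre_partition_def[of ?F] fibre
    by (auto simp: power_0_left)
qed

text \<open>
  Over the complex numbers both the linear factors and the leading coefficient have \<open>r\<close>-th roots; the
  latter is why no constant factor is left over.
\<close>

lemma poly_nth_root_exists:
  fixes R :: "complex poly"
  assumes "r > 0" "\<And>a. r dvd order a R"
  obtains P where "R = P ^ r"
proof -
  obtain s where s: "s ^ r = lead_coeff R"
  proof (cases "R = 0")
    case True
    then show thesis using that[of 0] assms(1) by simp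
  next
    case False
    then have "card {z. z ^ r = lead_coeff R} > 0"
      using assms(1) by (subst card_nth_roots) auto
    then show thesis using that by (auto simp: card_gt_0_iff)
  qed
  define T where "T = (\<Prod>z | poly R z = 0. [:- z, 1:] ^ (order z R div r))"
  have "T ^ r = (\<Prod>z | poly R z = 0. [:- z, 1:] ^ order z R)"
    using assms(2) by (simp add: T_def prod_power_distrib power_mult [symmetric])
  then have "R = smult s T ^ r"
    using complex_poly_decompose[of R] s by (simp add: smult_power)
  then show thesis by (rule that)
qed

text \<open>
  This transfers unramifiedness from \<open>g ^ r\<close> to \<open>g\<close>: the fibre partition of \<open>g\<close> is part of a
  trivial one, and its known sum determines the number of its parts.
\<close>

lemma all_ones_is_trivial_partition:
  assumes "is_partition k \<mu>" "\<mu> \<subseteq># trivial_partition d"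
  shows "\<mu> = trivial_partition k"
proof -
  have "m = 1" if "m \<in># \<mu>" for m
    using mset_subset_eqD[OF assms(2) that] by (auto simp: trivial_partition_def split: if_splits)
  then have "set_mset \<mu> \<subseteq> {1}" by auto
  then have \<mu>: "\<mu> = replicate_mset (size \<mu>) 1"
    using set_mset_subset_singletonD by metis
  have "\<Sum>\<^sub># \<mu> = size \<mu>" by (subst \<mu>) simp
  then show ?thesis using \<mu> assms(1) by (simp add: is_partition_def trivial_partition_def)
qed

section \<open>The decomposition theorem\<close>

theorem theorem1p1:
  fixes r k d :: nat
    and f :: "riemann_sphere \<Rightarrow> riemann_sphere"
    and \<alpha> x y :: "nat multiset"
  assumes "r \<ge> 2" and "k \<ge> 2" and "d = r * k"
    and "rational_map_of_degree d f"
    and "card (branching_points d f) = 3"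
    and "\<forall>a\<in>#\<alpha>. a > 0" and "\<forall>a\<in>#x. a > 0" and "\<forall>a\<in>#y. a > 0"
    and "branching_datum d f =
           {#\<alpha>, image_mset (\<lambda>a. r * a) x, image_mset (\<lambda>a. r * a) y#}"
  shows "\<exists>\<phi> \<psi> g (lam :: nat \<Rightarrow> nat multiset).
           moebius_transformation \<phi> \<and> moebius_transformation \<psi> \<and> rational_map_of_degree k g \<and>
           f = \<phi> \<circ> (\<lambda>z. sphere_power r (g z)) \<circ> \<psi> \<and>
           (\<forall>i\<in>{1..r}. is_partition k (lam i)) \<and>
           (\<Sum>i=1..r. lam i) = \<alpha> \<and>
           branching_datum k g =
             filter_mset (\<lambda>\<mu>. \<mu> \<noteq> trivial_partition k)
               ({#x, y#} + image_mset lam (mset_set {1..r}))"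
proof -
  have r: "r > 0" and k: "k > 0" using assms(1,2) by auto
  let ?B = "branching_points d f"
  have finB: "finite ?B" using assms(5) by (intro card_ge_0_finite) simp
  obtain P1 P2 P3 where B: "mset_set ?B = {#P1, P2, P3#}"
    and P: "fibre_partition f P1 = \<alpha>" "fibre_partition f P2 = image_mset ((*) r) x"
      "fibre_partition f P3 = image_mset ((*) r) y"
    using assms(9) unfolding branching_datum_def
    by (auto dest!: msed_map_invR)
  have "?B = {P1, P2, P3}"
    using arg_cong[OF B, of set_mset] finB by simp
  then have neq: "P1 \<noteq> P2" "P1 \<noteq> P3" "P2 \<noteq> P3"
    using assms(5) by (auto simp: card_insert_if split: if_splits)
  obtain a b c e where D: "a * e - b * c \<noteq> 0"
    and three: "rat_map [:b, a:] [:e, c:] (Some 0) = P2" "rat_map [:b, a:] [:e, c:] None = P3"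
      "rat_map [:b, a:] [:e, c:] (Some 1) = P1"
    by (rule moebius_through_three_points[OF neq])
  define \<phi> where "\<phi> = rat_map [:b, a:] [:e, c:]"
  obtain p q where pq: "reduced_fraction d p q" and f: "f = rat_map p q"
    using assms(3,4) r k by (auto simp: rational_map_of_degree_def reduced_fraction_def)

  obtain p' q' where pq': "reduced_fraction d p' q'" and f': "f = \<phi> \<circ> rat_map p' q'"
    unfolding \<phi>_def f by (rule rat_map_factors_through_moebius[OF pq D])

  have fib: "fibre_partition f (\<phi> w) = fibre_partition (rat_map p' q') w" for w
    unfolding f' \<phi>_def by (rule fibre_partition_moebius_comp[OF pq' D])

  \<comment> \<open>Finite zeros and poles suffice: they determine the polynomials, and the degree count in
    \<open>reduced_fraction_of_power\<close> then takes care of infinity.\<close>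
  have dvd_order: "r dvd order z (fibre_form p' q' w)"
    if "fibre_partition (rat_map p' q') w = image_mset ((*) r) \<mu>" for w \<mu> z
  proof (cases "order z (fibre_form p' q' w) = 0")
    case False
    have "finite {x. form_order d (fibre_form p' q' w) x > 0}"
      by (rule finite_form_zeros[OF fibre_form_nonzero[OF pq']])
    then have "form_order d (fibre_form p' q' w) (Some z) \<in># fibre_partition (rat_map p' q') w"
      unfolding fibre_partition_rat_map[OF pq'] using False by (auto intro!: image_eqI[of _ _ "Some z"])
    then show ?thesis unfolding that by auto
  qed simp
  have "r dvd order z p'" for z
    using dvd_order[of "Some 0" x z] P(2) fib[of "Some 0"] three by (simp add: \<phi>_def fibre_form_def)
  then obtain g1 where g1: "p' = g1 ^ r" using poly_nth_root_exists[OF r] by metis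
  have "r dvd order z q'" for z
    using dvd_order[of None y z] P(3) fib[of None] three by (simp add: \<phi>_def fibre_form_def)
  then obtain g2 where g2: "q' = g2 ^ r" using poly_nth_root_exists[OF r] by metis
  have G: "reduced_fraction k g1 g2"
    using reduced_fraction_of_power[of r k g1 g2] pq' assms(3) by (simp add: g1 g2)
  define g where "g = rat_map g1 g2"
  have part: "is_partition k (fibre_partition g w)" for w
    unfolding g_def by (rule is_partition_fibre_partition[OF G])

  have g_x: "fibre_partition g (Some 0) = x" and g_y: "fibre_partition g None = y"
  proof -
    have inj: "inj (image_mset ((*) r))" using r by (intro multiset.inj_map) (auto intro: injI)
    have "fibre_partition (rat_map p' q') (Some 0) = image_mset ((*) r) x"
      "fibre_partition (rat_map p' q') None = image_mset ((*) r) y"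
      using P(2,3) fib[of "Some 0"] fib[of None] three by (simp_all add: \<phi>_def)
    moreover have "fibre_partition (rat_map p' q') w = image_mset ((*) r) (fibre_partition g w)"
      if "w \<in> {Some 0, None}" for w
      unfolding g1 g2 g_def by (rule fibre_partition_power_ramified[OF G r that])
    ultimately show "fibre_partition g (Some 0) = x" "fibre_partition g None = y"
      using injD[OF inj] by (metis insertI1, metis insertI1 insertI2)
  qed

  let ?U = "{z :: complex. z ^ r = 1}"
  have "card {1..r} = card ?U" "finite ?U" using r card_roots_unity_eq finite_nth_roots by auto
  then obtain \<zeta> where \<zeta>: "bij_betw \<zeta> {1..r} ?U"
    using finite_same_card_bij by (metis finite_atLeastAtMost)
  define lam where "lam i = fibre_partition g (Some (\<zeta> i))" for i
  have sum_lam: "(\<Sum>i=1..r. lam i) = \<alpha>"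
    using fibre_partition_power_unramified[OF G r, of 1] P(1) fib[of "Some 1"] three
      sum.reindex_bij_betw[OF \<zeta>, of "\<lambda>z. fibre_partition g (Some z)"]
    by (simp add: lam_def g_def g1 g2 \<phi>_def)

  \<comment> \<open>Distinct points may carry equal partitions, so the datum of \<open>g\<close> is computed by filtering the
    partitions over an explicit finite set of points that contains all branching points.\<close>
  let ?S = "{Some 0, None} \<union> Some ` ?U"
  have "fibre_partition g w = trivial_partition k" if w: "w \<notin> ?S" for w
  proof -
    from w obtain t where t: "w = Some t" "t \<noteq> 0" "t ^ r \<noteq> 1" by (cases w) auto
    have "\<phi> (Some (t ^ r)) \<notin> \<phi> ` {Some 1, Some 0, None}"
      using t(2,3) unfolding \<phi>_def inj_image_mem_iff[OF inj_moebius[OF D]]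
      by simp
    then have "\<phi> (Some (t ^ r)) \<notin> ?B"
      using three \<open>?B = {P1, P2, P3}\<close> by (simp add: \<phi>_def)
    then have "fibre_partition (rat_map p' q') (Some (t ^ r)) = trivial_partition d"
      by (simp add: branching_points_def fib)
    moreover have "fibre_partition g (Some t) \<subseteq># fibre_partition (rat_map p' q') (Some (t ^ r))"
      unfolding g1 g2 fibre_partition_power_unramified[OF G r power_not_zero[OF t(2)]] g_def
      using finite_nth_roots[of r "t ^ r"] r t(2) by (simp add: sum.remove[of _ t])
    ultimately show ?thesis
      using all_ones_is_trivial_partition[OF part] t(1) by metis
  qed
  then have sub: "branching_points k g \<subseteq> ?S" unfolding branching_points_def by blast
  have "branching_points k g = {w\<in>?S. fibre_partition g w \<noteq> trivial_partition k}"
    using sub by (auto simp: branching_points_def)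
  then have "branching_datum k g =
      filter_mset (\<lambda>\<mu>. \<mu> \<noteq> trivial_partition k) (image_mset (fibre_partition g) (mset_set ?S))"
    using \<open>finite ?U\<close> by (simp add: branching_datum_def filter_mset_image_mset)
  also have "mset_set ?S = {#Some 0, None#} + image_mset Some (mset_set ?U)"
    using \<open>finite ?U\<close> r
    by (subst mset_set_Union) (auto simp: image_mset_mset_set power_0_left)
  also have "mset_set ?U = image_mset \<zeta> (mset_set {1..r})"
    using \<zeta> by (auto simp: image_mset_mset_set bij_betw_def)
  finally have "branching_datum k g = filter_mset (\<lambda>\<mu>. \<mu> \<noteq> trivial_partition k)
      ({#x, y#} + image_mset lam (mset_set {1..r}))"
    by (simp add: g_x g_y multiset.map_comp o_def lam_def [abs_def])
  moreover have "f = \<phi> \<circ> (\<lambda>z. sphere_power r (g z)) \<circ> rat_map [:0, 1:] [:1, 0:]"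
  proof -
    have "rat_map [:0, 1:] [:1, 0:] w = w" for w
      by (cases w) (auto simp: sphere_quotient_def)
    then show ?thesis
      by (auto simp: f' g_def g1 g2 rat_map_power[OF G r] fun_eq_iff)
  qed
  moreover have "moebius_transformation \<phi>"
    using D unfolding moebius_transformation_def \<phi>_def by blast
  moreover have "moebius_transformation (rat_map [:0, 1:] [:1, 0:])"
    unfolding moebius_transformation_def by (intro exI[of _ 1] exI[of _ 0] conjI refl) simp
  moreover have "rational_map_of_degree k g"
    unfolding rational_map_of_degree_def
  proof (intro exI conjI)
    show "coprime g1 g2" "max (degree g1) (degree g2) = k" "g = rat_map g1 g2"
      using G by (simp_all add: reduced_fraction_def g_def)
    show "g2 \<noteq> 0" using fibre_form_nonzero[OF G, of None] by (simp add: fibre_form_def)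
  qed
  moreover have "\<forall>i\<in>{1..r}. is_partition k (lam i)"
    by (simp add: lam_def part)
  ultimately show ?thesis using sum_lam by blast
qed

end
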